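(* For a nonnegative integer $n$, let $b_{21}(n)$ denote the number of $21$-regular partitions of $n$. Let $\beta\in\{8,37,66,95,124,153,182,211,240,269,298,327,356,414,443,472,501,530,559,588,617,646,675,704,733,762,791,820\}$. Then for all integers $n\geq 0$, $$b_{21}(4(29^2\cdot n+\beta)+1)\equiv 0\pmod 2.$$
   Context: For a positive integer $\ell$, an $\ell$-regular partition of $n$ is a partition of $n$ none of whose parts is divisible by $\ell$; $b_\ell(n)$ denotes the number of $\ell$-regular partitions of $n$, with $b_\ell(0)=1$. Equivalently, $\sum_{n=0}^{\infty}b_{\ell}(n)q^n=\prod_{j=1}^{\infty}\frac{1-q^{\ell j}}{1-q^{j}}$. *)

theory Defs
  imports "HOL-Library.Multiset" "HOL-Number_Theory.Cong"
begin

text \<open>A partition of \<open>n\<close> is encoded as the finite multiset of its (positive) parts.\<close>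

definition is_partition :: "nat \<Rightarrow> nat multiset \<Rightarrow> bool" where
  "is_partition n p \<longleftrightarrow> (\<forall>k \<in># p. 0 < k) \<and> sum_mset p = n"

definition regular_partitions :: "nat \<Rightarrow> nat \<Rightarrow> nat multiset set" where
  "regular_partitions l n = {p. is_partition n p \<and> (\<forall>k \<in># p. \<not> l dvd k)}"

definition num_regular_partitions :: "nat \<Rightarrow> nat \<Rightarrow> nat" where
  "num_regular_partitions l n = card (regular_partitions l n)"

text \<open>The set being counted is finite, so the cardinality is the genuine count.\<close>

lemma size_le_sum_mset:
  fixes p :: "nat multiset"
  assumes "\<forall>k \<in># p. 0 < k"
  shows "size p \<le> sum_mset p"
  using assms by (induction p) auto

lemma finite_regular_partitions: "finite (regular_partitions l n)"
proof (rule finite_subset)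
  show "regular_partitions l n \<subseteq> (\<Union>m\<in>{..n}. multisets_of_size {..n} m)"
  proof
    fix p assume "p \<in> regular_partitions l n"
    then have pos: "\<forall>k \<in># p. 0 < k" and sum: "sum_mset p = n"
      by (auto simp: regular_partitions_def is_partition_def)
    have "k \<le> n" if "k \<in># p" for k
      using multi_member_split[OF that] sum by auto
    moreover have "size p \<le> n"
      using size_le_sum_mset[OF pos] sum by simp
    ultimately show "p \<in> (\<Union>m\<in>{..n}. multisets_of_size {..n} m)"
      by (auto simp: multisets_of_size_def)
  qed
  show "finite (\<Union>m\<in>{..n}. multisets_of_size {..n} m)"
    by (auto intro!: finite_multisets_of_size)
qed

lemma num_regular_partitions_0: "num_regular_partitions l 0 = 1"
proof -
  have "regular_partitions l 0 = {{#}}"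
    by (auto simp: regular_partitions_def is_partition_def)
       (metis multiset_nonemptyE less_irrefl)
  then show ?thesis
    by (simp add: num_regular_partitions_def)
qed

end

theory Submission
  imports Defs "HOL-Library.Z2" "HOL-Computational_Algebra.Formal_Power_Series"
    "HOL-Computational_Algebra.Primes"
begin

text \<open>Write \<open>f\<^sub>k = \<Prod> (1 - q^(ki))\<close> and work over the field with two elements, where
  \<open>f\<^sub>2\<^sub>k = f\<^sub>k^2\<close>. Then \<open>(\<Sum> b(n) q^n) f\<^sub>4 = f\<^sub>1^3 f\<^sub>2\<^sub>1\<close>. By Jacobi's triple product the
  coefficient of the right-hand side at \<open>4m + 1\<close> counts representations of \<open>16(2m + 1)\<close> by
  \<open>a^2 + 7y^2\<close>, and an involution coming from \<open>\<rat>(\<surd>-7)\<close> leaves only the case where \<open>2m + 1\<close> is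
  a square prime to 6: the section at exponents \<open>4m + 1\<close> is \<open>f\<^sub>1\<^sub>2\<close>. Hence
  \<open>\<Sum> b(4m + 1) q^m = f\<^sub>1\<^sub>2 / f\<^sub>1 = f\<^sub>3 (f\<^sub>3^3 / f\<^sub>1)\<close>, a product of two theta series, so that \<open>b(4m + 1)\<close>
  has the parity of the number of normalised representations of \<open>24m + 11\<close> by \<open>8z^2 + 3y^2\<close>. When 29
  divides \<open>24m + 11\<close> exactly once, multiplication by \<open>(25 + 6\<surd>-6)/29\<close> pairs them off.\<close>

unbundle fps_syntax

subsection \<open>Infinite products over the field with two elements\<close>

text \<open>Congruence modulo \<open>X^(n+1)\<close>. It takes the place of convergence: infinite
  products are compared with finite ones at every \<open>n\<close>.\<close>

definition agree :: "nat \<Rightarrow> 'a::zero fps \<Rightarrow> 'a fps \<Rightarrow> bool" where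
  "agree n F G \<longleftrightarrow> (\<forall>i\<le>n. F $ i = G $ i)"

lemma agree_refl [simp]: "agree n F F"
  by (simp add: agree_def)

lemma agree_sym: "agree n F G \<Longrightarrow> agree n G F"
  by (simp add: agree_def)

lemma agree_trans [trans]: "agree n F G \<Longrightarrow> agree n G H \<Longrightarrow> agree n F H"
  by (simp add: agree_def)

lemma agree_mult:
  assumes "agree n F F'" "agree n G G'"
  shows "agree n (F * G) (F' * G')"
  using assms unfolding agree_def fps_mult_nth by (auto intro!: sum.cong)

lemma agree_cancel:
  fixes F G H :: "'a::field fps"
  assumes "agree n (F * H) (G * H)" "H $ 0 \<noteq> 0"
  shows "agree n F G"
proof -
  have "agree n (F * H * inverse H) (G * H * inverse H)"
    using assms(1) by (rule agree_mult) simp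
  then show ?thesis
    using assms(2) by (simp add: mult.assoc inverse_mult_eq_1')
qed

lemma agree_imp_eq: "(\<And>n. agree n F G) \<Longrightarrow> F = G"
  by (auto simp: agree_def fps_eq_iff)

lemma bit_fps_2 [simp]: "(2 :: bit fps) = 0"
  by (simp add: numeral_fps_const)

lemma bit_fps_add_self [simp]: "F + F = (0 :: bit fps)"
  by (simp flip: mult_2)

lemma bit_fps_diff [simp]: "F - G = F + (G :: bit fps)"
  by (metis add_diff_cancel_right' add_diff_eq bit_fps_add_self add.right_neutral)

text \<open>Coefficient \<open>n\<close> is read off from the factors with \<open>i \<le> n\<close>,
  the only ones that affect it. Over two elements \<open>1 + X^i\<close> is
  \<open>1 - X^i\<close>.\<close>

definition euler_prod :: "nat set \<Rightarrow> bit fps" where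
  "euler_prod S = Abs_fps (\<lambda>n. (\<Prod>i\<in>S \<inter> {..n}. 1 + fps_X ^ i) $ n)"

lemma agree_prod_extend:
  assumes "finite A" "B \<subseteq> A" "\<And>i. i \<in> A - B \<Longrightarrow> n < i"
  shows "agree n (\<Prod>i\<in>A. 1 + fps_X ^ i :: bit fps) (\<Prod>i\<in>B. 1 + fps_X ^ i)"
proof -
  have "agree n (\<Prod>i\<in>C. 1 + fps_X ^ i :: bit fps) 1" if "finite C" "\<And>i. i \<in> C \<Longrightarrow> n < i" for C
    using that
  proof (induction C rule: finite_induct)
    case (insert x C)
    have "agree n (1 + fps_X ^ x :: bit fps) 1"
      using insert.prems[of x] by (auto simp: agree_def fps_X_power_nth)
    from agree_mult[OF this insert.IH] show ?case
      using insert by simp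
  qed simp
  from agree_mult[OF this agree_refl, of "A - B" "\<Prod>i\<in>B. 1 + fps_X ^ i"] show ?thesis
    using assms by (simp add: prod.subset_diff[OF assms(2,1)])
qed

lemma agree_euler_prod:
  assumes "finite A" "S \<inter> {..n} \<subseteq> A" "A \<subseteq> S"
  shows "agree n (euler_prod S) (\<Prod>i\<in>A. 1 + fps_X ^ i)"
  unfolding agree_def
proof (intro allI impI)
  fix m assume "m \<le> n"
  then have "agree m (\<Prod>i\<in>A. 1 + fps_X ^ i :: bit fps) (\<Prod>i\<in>S \<inter> {..m}. 1 + fps_X ^ i)"
    using assms by (intro agree_prod_extend) auto
  then show "euler_prod S $ m = (\<Prod>i\<in>A. 1 + fps_X ^ i) $ m"
    by (simp add: euler_prod_def agree_def)
qed

lemma euler_prod_union: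
  assumes "S \<inter> T = {}"
  shows "euler_prod (S \<union> T) = euler_prod S * euler_prod T"
proof (rule agree_imp_eq)
  fix n
  have "agree n (euler_prod (S \<union> T)) (\<Prod>i\<in>(S \<inter> {..n}) \<union> (T \<inter> {..n}). 1 + fps_X ^ i)"
    by (rule agree_euler_prod) auto
  also have "(\<Prod>i\<in>(S \<inter> {..n}) \<union> (T \<inter> {..n}). 1 + fps_X ^ i :: bit fps) =
      (\<Prod>i\<in>S \<inter> {..n}. 1 + fps_X ^ i) * (\<Prod>i\<in>T \<inter> {..n}. 1 + fps_X ^ i)"
    using assms by (intro prod.union_disjoint) auto
  also have "agree n \<dots> (euler_prod S * euler_prod T)"
    by (intro agree_mult agree_sym[OF agree_euler_prod]) auto
  finally show "agree n (euler_prod (S \<union> T)) (euler_prod S * euler_prod T)" .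
qed

text \<open>The Frobenius map: \<open>(1 + X^i)^2 = 1 + X^(2i)\<close>. It is the source of
  \<open>euler_square\<close>.\<close>

lemma euler_prod_square: "euler_prod S ^ 2 = euler_prod ((*) 2 ` S)"
proof (rule agree_imp_eq)
  fix n
  have sq: "(1 + fps_X ^ i :: bit fps) ^ 2 = 1 + fps_X ^ (2 * i)" for i
    by (simp add: power2_sum mult.commute flip: power_mult)
  have "agree n (euler_prod S ^ 2) ((\<Prod>i\<in>S \<inter> {..n}. 1 + fps_X ^ i) ^ 2)"
    unfolding power2_eq_square by (intro agree_mult agree_euler_prod) auto
  also have "(\<Prod>i\<in>S \<inter> {..n}. 1 + fps_X ^ i :: bit fps) ^ 2 = (\<Prod>i\<in>S \<inter> {..n}. 1 + fps_X ^ (2 * i))"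
    by (simp add: prod_power_distrib sq)
  also have "\<dots> = (\<Prod>i\<in>(*) 2 ` (S \<inter> {..n}). 1 + fps_X ^ i)"
    by (subst prod.reindex) (auto simp: inj_on_def)
  also have "agree n \<dots> (euler_prod ((*) 2 ` S))"
    by (rule agree_sym[OF agree_euler_prod]) auto
  finally show "agree n (euler_prod S ^ 2) (euler_prod ((*) 2 ` S))" .
qed

lemma euler_prod_nth_0: "0 \<notin> S \<Longrightarrow> euler_prod S $ 0 = 1"
  by (simp add: euler_prod_def)

section \<open>Generating functions of partitions with restricted parts\<close>

definition partitions_in :: "nat set \<Rightarrow> nat \<Rightarrow> nat multiset set" where
  "partitions_in S n = {p. set_mset p \<subseteq> S \<and> sum_mset p = n}"

lemma finite_partitions_in:
  assumes "0 \<notin> S"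
  shows "finite (partitions_in S n)"
proof (rule finite_subset)
  have "size p \<le> sum_mset p" if "set_mset p \<subseteq> S" for p
    by (rule size_le_sum_mset) (use that assms in \<open>metis neq0_conv subsetD\<close>)
  moreover have "k \<le> sum_mset p" if "k \<in># p" for k and p :: "nat multiset"
    using multi_member_split[OF that] by auto
  ultimately show "partitions_in S n \<subseteq> (\<Union>m\<in>{..n}. multisets_of_size {..n} m)"
    by (force simp: partitions_in_def multisets_of_size_def)
  show "finite (\<Union>m\<in>{..n}. multisets_of_size {..n} m)"
    by (auto intro!: finite_multisets_of_size)
qed

text \<open>A partition either avoids \<open>k\<close> or loses one copy of \<open>k\<close>, and
  the remainder may still contain \<open>k\<close>.\<close>

lemma card_partitions_in_insert:
  assumes "0 \<notin> S" "k \<notin> S" "k > 0"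
  shows "card (partitions_in (insert k S) n) =
    card (partitions_in S n) + (if k \<le> n then card (partitions_in (insert k S) (n - k)) else 0)"
proof -
  define W where "W = {p \<in> partitions_in (insert k S) n. k \<in># p}"
  have "partitions_in (insert k S) n = partitions_in S n \<union> W"
    using assms(2) by (auto simp: partitions_in_def W_def)
  moreover have "partitions_in S n \<inter> W = {}"
    using assms(2) by (auto simp: partitions_in_def W_def)
  moreover have "finite (partitions_in (insert k S) n)"
    using assms by (intro finite_partitions_in) auto
  ultimately have "card (partitions_in (insert k S) n) = card (partitions_in S n) + card W"
    by (metis card_Un_disjoint finite_Un)
  moreover have "card W = (if k \<le> n then card (partitions_in (insert k S) (n - k)) else 0)"
  proof (cases "k \<le> n")
    case True
    have "bij_betw (add_mset k) (partitions_in (insert k S) (n - k)) W"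
    proof (rule bij_betw_byWitness[where f' = "\<lambda>p. p - {#k#}"])
      show "(\<lambda>p. p - {#k#}) ` W \<subseteq> partitions_in (insert k S) (n - k)"
      proof
        fix p assume "p \<in> (\<lambda>p. p - {#k#}) ` W"
        then obtain r where r: "r \<in> W" "p = r - {#k#}" by auto
        from r(1) obtain s where "r = add_mset k s"
          unfolding W_def by (auto dest: multi_member_split)
        with r show "p \<in> partitions_in (insert k S) (n - k)"
          by (auto simp: W_def partitions_in_def)
      qed
    qed (use True in \<open>auto simp: W_def partitions_in_def\<close>)
    with True show ?thesis
      by (simp add: bij_betw_same_card)
  next
    case False
    have "W = {}"
      using False by (auto simp: W_def partitions_in_def dest!: multi_member_split)
    with False show ?thesis by simp
  qed
  ultimately show ?thesis by simp
qed

definition partition_gf :: "nat set \<Rightarrow> bit fps" where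
  "partition_gf S = Abs_fps (\<lambda>n. of_nat (card (partitions_in S n)))"

text \<open>For a new part \<open>k\<close> the recurrence reads \<open>G' = G + X^k G'\<close>, so
  each part contributes a factor \<open>1 / (1 + X^k)\<close>.\<close>

lemma partition_gf_finite:
  assumes "finite S" "0 \<notin> S"
  shows "partition_gf S * (\<Prod>i\<in>S. 1 + fps_X ^ i) = 1"
  using assms
proof (induction S rule: finite_induct)
  case empty
  have "partitions_in {} n = (if n = 0 then {{#}} else {})" for n
    by (auto simp: partitions_in_def)
  then show ?case
    by (simp add: partition_gf_def fps_eq_iff)
next
  case (insert k S)
  have "partition_gf (insert k S) = partition_gf S + fps_X ^ k * partition_gf (insert k S)"
    using insert.prems insert.hyps card_partitions_in_insert[of S k]
    by (auto simp: fps_eq_iff partition_gf_def fps_X_power_mult_nth)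
  then have "partition_gf (insert k S) * (1 + fps_X ^ k) = partition_gf S"
    by (metis (no_types, lifting) add.assoc add.right_neutral bit_fps_add_self distrib_left
        mult.commute mult.right_neutral)
  then show ?case
    using insert by (simp flip: mult.assoc)
qed

lemma partition_gf_mult_euler_prod:
  assumes "0 \<notin> S"
  shows "partition_gf S * euler_prod S = 1"
proof (rule agree_imp_eq)
  fix n
  have "partitions_in S m = partitions_in (S \<inter> {..n}) m" if "m \<le> n" for m
    using that by (auto simp: partitions_in_def dest!: multi_member_split)
  then have "agree n (partition_gf S) (partition_gf (S \<inter> {..n}))"
    by (simp add: agree_def partition_gf_def)
  moreover have "agree n (euler_prod S) (\<Prod>i\<in>S \<inter> {..n}. 1 + fps_X ^ i)"
    by (rule agree_euler_prod) auto
  ultimately have "agree n (partition_gf S * euler_prod S)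
      (partition_gf (S \<inter> {..n}) * (\<Prod>i\<in>S \<inter> {..n}. 1 + fps_X ^ i))"
    by (rule agree_mult)
  then show "agree n (partition_gf S * euler_prod S) 1"
    using assms by (simp add: partition_gf_finite)
qed

subsection \<open>Jacobi's triple product\<close>

text \<open>The q-binomial coefficient. The q-Pascal rule involves no division, so \<open>q\<close>
  may be a power series.\<close>

fun gauss_binomial :: "'a::comm_ring_1 \<Rightarrow> nat \<Rightarrow> nat \<Rightarrow> 'a" where
  "gauss_binomial q n 0 = 1"
| "gauss_binomial q 0 (Suc j) = 0"
| "gauss_binomial q (Suc n) (Suc j) = gauss_binomial q n (Suc j) + q ^ (n - j) * gauss_binomial q n j"

lemma gauss_binomial_eq_0: "n < j \<Longrightarrow> gauss_binomial q n j = 0"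
  by (induction q n j rule: gauss_binomial.induct) auto

text \<open>The usual quotient of q-factorials, cleared of denominators.\<close>

lemma gauss_binomial_mult:
  assumes "j \<le> n"
  shows "gauss_binomial q n j * (\<Prod>i=1..j. 1 - q ^ i) * (\<Prod>i=1..n - j. 1 - q ^ i) =
    (\<Prod>i=1..n. 1 - q ^ i)"
  using assms
proof (induction q n j rule: gauss_binomial.induct)
  case (3 q n j)
  let ?P = "\<lambda>m. \<Prod>i=1..m. 1 - q ^ i"
  let ?g = "gauss_binomial q n"
  have A: "?g j * ?P j * ?P (n - j) = ?P n"
    using 3 by simp
  have B: "?g (Suc j) * ?P (Suc j) * ?P (n - j) = (1 - q ^ (n - j)) * ?P n"
  proof (cases "j < n")
    case True
    then have "n - j = Suc (n - Suc j)" by simp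
    then have "?P (n - j) = (1 - q ^ (n - j)) * ?P (n - Suc j)"
      by (simp add: mult.commute)
    then have "?g (Suc j) * ?P (Suc j) * ?P (n - j) =
        (1 - q ^ (n - j)) * (?g (Suc j) * ?P (Suc j) * ?P (n - Suc j))"
      by (simp only: mult_ac)
    also have "?g (Suc j) * ?P (Suc j) * ?P (n - Suc j) = ?P n"
      using 3(1) True by simp
    finally show ?thesis .
  next
    \<comment> \<open>Here \<open>j = n\<close> and both sides vanish: the coefficient lies outside
      the triangle, and \<open>1 - q^0 = 0\<close>.\<close>
    case False
    then show ?thesis using 3(3) by (simp add: gauss_binomial_eq_0)
  qed
  \<comment> \<open>Both terms of the q-Pascal rule are multiples of \<open>?P n\<close>; the
    factors \<open>1 - q^(n-j)\<close> and \<open>q^(n-j) (1 - q^(j+1))\<close> add up to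
    \<open>1 - q^(n+1)\<close>.\<close>
  have "gauss_binomial q (Suc n) (Suc j) * ?P (Suc j) * ?P (Suc n - Suc j) =
      ?g (Suc j) * ?P (Suc j) * ?P (n - j) + q ^ (n - j) * (1 - q ^ Suc j) * (?g j * ?P j * ?P (n - j))"
    by (simp add: algebra_simps)
  also have "\<dots> = (1 - q ^ (n - j) * q ^ Suc j) * ?P n"
    unfolding A B by (simp add: algebra_simps)
  also have "q ^ (n - j) * q ^ Suc j = q ^ Suc n"
    using 3(3) by (simp del: power_Suc flip: power_add)
  finally show ?case by (simp add: mult.commute)
qed auto

text \<open>Homogeneous in \<open>x\<close> and \<open>y\<close> because \<open>y\<close> will be a
  positive power of \<open>X\<close>, which has no inverse. The exponent \<open>\<Sum>{..<j}\<close>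
  is \<open>j (j - 1) / 2\<close>.\<close>

lemma gauss_binomial_theorem:
  fixes x y q :: "'a::comm_ring_1"
  shows "(\<Prod>i<n. y + x * q ^ i) =
    (\<Sum>j\<le>n. q ^ (\<Sum>{..<j}) * gauss_binomial q n j * x ^ j * y ^ (n - j))"
proof (induction n)
  case (Suc n)
  let ?g = "gauss_binomial q"
  let ?t = "\<lambda>n j. q ^ (\<Sum>{..<j}) * ?g n j * x ^ j * y ^ (n - j)"
  \<comment> \<open>The extra term \<open>j = n + 1\<close> has coefficient 0. Splitting off
    \<open>j = 0\<close> aligns the sum with the first half of the q-Pascal rule.\<close>
  have "(\<Sum>j\<le>n. ?t n j) * y = (\<Sum>j\<le>Suc n. q ^ (\<Sum>{..<j}) * ?g n j * x ^ j * y ^ (Suc n - j))"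
    by (auto simp: sum_distrib_right gauss_binomial_eq_0 Suc_diff_le intro!: sum.cong)
  also have "\<dots> = y ^ Suc n + (\<Sum>j\<le>n. q ^ (\<Sum>{..<Suc j}) * ?g n (Suc j) * x ^ Suc j * y ^ (n - j))"
    by (subst sum.atMost_Suc_shift) simp
  finally have 1: "(\<Sum>j\<le>n. ?t n j) * y = \<dots>" .
  have 2: "(\<Sum>j\<le>n. ?t n j) * (x * q ^ n) =
      (\<Sum>j\<le>n. q ^ (\<Sum>{..<Suc j}) * (q ^ (n - j) * ?g n j) * x ^ Suc j * y ^ (n - j))"
    unfolding sum_distrib_right
  proof (rule sum.cong)
    fix j assume "j \<in> {..n}"
    then have "q ^ n = q ^ j * q ^ (n - j)" by (simp flip: power_add)
    then show "?t n j * (x * q ^ n) =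
        q ^ (\<Sum>{..<Suc j}) * (q ^ (n - j) * ?g n j) * x ^ Suc j * y ^ (n - j)"
      by (simp add: power_add mult_ac)
  qed simp
  have "(\<Prod>i<Suc n. y + x * q ^ i) = (\<Sum>j\<le>n. ?t n j) * y + (\<Sum>j\<le>n. ?t n j) * (x * q ^ n)"
    by (simp add: Suc distrib_left)
  also have "\<dots> = y ^ Suc n + (\<Sum>j\<le>n. ?t (Suc n) (Suc j))"
    unfolding 1 2 by (simp add: sum.distrib[symmetric] algebra_simps del: sum.lessThan_Suc)
  also have "\<dots> = (\<Sum>j\<le>Suc n. ?t (Suc n) j)"
    by (subst sum.atMost_Suc_shift) simp
  finally show ?case .
qed simp

text \<open>The exponents of Ramanujan's theta function \<open>f(X^a, X^b)\<close>. The numerator is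
  even and nonnegative, so neither \<open>div\<close> nor \<open>nat\<close> loses anything;
  computations go through \<open>two_theta_exp\<close>.\<close>

definition theta_exp :: "nat \<Rightarrow> nat \<Rightarrow> int \<Rightarrow> nat" where
  "theta_exp a b t = nat ((int a * (t * (t + 1)) + int b * (t * (t - 1))) div 2)"

lemma two_theta_exp: "2 * int (theta_exp a b t) = int a * (t * (t + 1)) + int b * (t * (t - 1))"
proof -
  have "0 \<le> t * (t + 1)" "0 \<le> t * (t - 1)"
    unfolding zero_le_mult_iff by linarith+
  then have "0 \<le> int a * (t * (t + 1)) + int b * (t * (t - 1))" by simp
  moreover have "even (int a * (t * (t + 1)) + int b * (t * (t - 1)))" by simp
  moreover have "2 * int (nat (x div 2)) = x" if "0 \<le> x" "even x" for x
    using that by auto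
  ultimately show ?thesis unfolding theta_exp_def by blast
qed

text \<open>The exponent is at least \<open>t^2\<close>, its value for \<open>a = b = 1\<close>.
  Hence only small \<open>t\<close> reach a given coefficient.\<close>

lemma abs_le_theta_exp:
  assumes "a > 0" "b > 0"
  shows "\<bar>t\<bar> \<le> int (theta_exp a b t)"
proof -
  have "0 \<le> t * (t + 1)" "0 \<le> t * (t - 1)"
    unfolding zero_le_mult_iff by linarith+
  then have "1 * (t * (t + 1)) + 1 * (t * (t - 1)) \<le> int a * (t * (t + 1)) + int b * (t * (t - 1))"
    using assms by (intro add_mono mult_right_mono) auto
  then have "\<bar>t\<bar> * \<bar>t\<bar> \<le> int (theta_exp a b t)"
    unfolding two_theta_exp[symmetric] by (simp add: algebra_simps)
  moreover have "\<bar>t\<bar> * 1 \<le> \<bar>t\<bar> * \<bar>t\<bar>"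
    by (cases "t = 0") (simp, rule mult_left_mono, auto)
  ultimately show ?thesis by simp
qed

lemma finite_theta_exp:
  assumes "a > 0" "b > 0"
  shows "finite {t. theta_exp a b t = n}"
proof (rule finite_subset)
  show "{t. theta_exp a b t = n} \<subseteq> {- int n..int n}"
    using abs_le_theta_exp[OF assms] by (auto simp: abs_le_iff) (smt (verit))+
qed simp

text \<open>The \<open>q\<close>-binomial theorem for \<open>q = X^(a+b)\<close>, \<open>x = 1\<close>, \<open>y = X^c\<close> with \<open>c = (a+b)N - a\<close>, divided
  by a power of \<open>X\<close>.\<close>

lemma finite_triple_product:
  assumes "a > 0" "b > 0" "N > 0"
  shows "(\<Prod>i<N. 1 + fps_X ^ (a + (a + b) * i)) * (\<Prod>i<N. 1 + fps_X ^ (b + (a + b) * i)) =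
    (\<Sum>j\<le>2 * N. fps_X ^ theta_exp a b (int j - int N) * gauss_binomial (fps_X ^ (a + b)) (2 * N) j
      :: 'a::idom fps)"
    (is "?A * ?B = ?R")
proof -
  define k where "k = a + b"
  obtain c where c: "c + a = k * N"
    using assms(3) by (cases N) (auto simp: k_def intro: that)
  let ?S = "\<lambda>j. \<Sum>{..<j::nat}"
  have S: "2 * int (?S j) = int j * (int j - 1)" for j
    by (induction j) (auto simp: algebra_simps)
  have exps: "k * ?S j + c * (2 * N - j) = k * ?S N + c * N + theta_exp a b (int j - int N)"
    if "j \<le> 2 * N" for j
  proof -
    have c': "int c = (int a + int b) * int N - int a"
      using c unfolding k_def by (metis add_diff_cancel_right' of_nat_add of_nat_mult)
    have "2 * int (k * ?S j + c * (2 * N - j)) =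
        int k * (2 * int (?S j)) + 2 * int c * (2 * int N - int j)"
      using that by (simp add: of_nat_diff)
    also have "\<dots> = int k * (2 * int (?S N)) + 2 * int c * int N + 2 * int (theta_exp a b (int j - int N))"
      unfolding S two_theta_exp c' by (simp add: k_def algebra_simps)
    also have "\<dots> = 2 * int (k * ?S N + c * N + theta_exp a b (int j - int N))"
      by (simp add: algebra_simps)
    finally show ?thesis
      by (simp only: mult_cancel_left of_nat_eq_iff) simp
  qed
  have prod_split: "(\<Prod>i<m + n. f i) = (\<Prod>i<m. f i) * (\<Prod>i<n. f (m + i))" for f :: "nat \<Rightarrow> 'a fps" and m n
    by (induction n) (simp_all add: mult.assoc)
  have "(\<Prod>i<2 * N. fps_X ^ c + 1 * (fps_X ^ k) ^ i :: 'a fps) =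
      (\<Prod>i<N. fps_X ^ c + fps_X ^ (k * i)) * (\<Prod>i<N. fps_X ^ c + fps_X ^ (k * (N + i)))"
    by (simp add: mult_2 prod_split flip: power_mult)
  \<comment> \<open>The smaller power is taken out of each factor: \<open>X^c\<close> in the upper
    half, which leaves \<open>?A\<close>, and \<open>X^(k*i)\<close> in the lower half, which leaves
    \<open>?B\<close> in reverse order.\<close>
  also have "(\<Prod>i<N. fps_X ^ c + fps_X ^ (k * (N + i)) :: 'a fps) = fps_X ^ (c * N) * ?A"
  proof -
    have "fps_X ^ c + fps_X ^ (k * (N + i)) = fps_X ^ c * (1 + fps_X ^ (a + k * i) :: 'a fps)" for i
      unfolding distrib_left power_add[symmetric] c[symmetric] by (simp add: algebra_simps flip: c)
    then show ?thesis by (simp add: prod.distrib power_mult k_def)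
  qed
  also have "(\<Prod>i<N. fps_X ^ c + fps_X ^ (k * i) :: 'a fps) =
      (\<Prod>i<N. fps_X ^ (k * i) * (1 + fps_X ^ (b + k * (N - Suc i))))"
  proof (rule prod.cong)
    fix i assume "i \<in> {..<N}"
    then obtain d where d: "N = Suc (i + d)" by (auto dest: less_imp_Suc_add)
    have "c = k * i + (b + k * d)"
      using c unfolding d k_def by (simp add: algebra_simps)
    then show "fps_X ^ c + fps_X ^ (k * i) = fps_X ^ (k * i) * (1 + fps_X ^ (b + k * (N - Suc i)) :: 'a fps)"
      using d by (simp add: distrib_left power_add add.commute)
  qed simp
  also have "\<dots> = fps_X ^ (k * ?S N) * ?B"
    using prod.nat_diff_reindex[of "\<lambda>i. 1 + fps_X ^ (b + k * i) :: 'a fps" N]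
    by (simp add: prod.distrib k_def power_sum sum_distrib_left)
  finally have "fps_X ^ (k * ?S N + c * N) * (?A * ?B) =
      (\<Prod>i<2 * N. fps_X ^ c + 1 * (fps_X ^ k) ^ i)"
    by (simp add: power_add mult_ac)
  also have "\<dots> = (\<Sum>j\<le>2 * N. fps_X ^ (k * ?S j + c * (2 * N - j)) * gauss_binomial (fps_X ^ k) (2 * N) j)"
    unfolding gauss_binomial_theorem by (simp add: power_add mult_ac flip: power_mult)
  also have "\<dots> = fps_X ^ (k * ?S N + c * N) * ?R"
    unfolding sum_distrib_left[of "fps_X ^ (k * ?S N + c * N) :: 'a fps"]
  proof (intro sum.cong refl)
    fix j assume "j \<in> {..2 * N}"
    then have "j \<le> 2 * N" by simp
    from exps[OF this] show "fps_X ^ (k * ?S j + c * (2 * N - j)) * gauss_binomial (fps_X ^ k) (2 * N) j =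
        fps_X ^ (k * ?S N + c * N) * (fps_X ^ theta_exp a b (int j - int N) *
          gauss_binomial (fps_X ^ (a + b)) (2 * N) j :: 'a fps)"
      by (simp only: power_add mult.assoc k_def)
  qed
  finally show ?thesis by simp
qed

definition theta :: "nat \<Rightarrow> nat \<Rightarrow> bit fps" where
  "theta a b = Abs_fps (\<lambda>n. of_nat (card {t. theta_exp a b t = n}))"

lemma agree_euler_prod_range:
  assumes "inj f" "\<And>i. i \<le> f i" "n < N"
  shows "agree n (euler_prod (range f)) (\<Prod>i<N. 1 + fps_X ^ f i)"
proof -
  have "agree n (euler_prod (range f)) (\<Prod>i\<in>f ` {..<N}. 1 + fps_X ^ i)"
  proof (rule agree_euler_prod)
    show "range f \<inter> {..n} \<subseteq> f ` {..<N}"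
      using assms(2,3) by (auto intro!: imageI) (meson le_trans not_le order.strict_trans1)
  qed auto
  then show ?thesis
    using assms(1) by (simp add: prod.reindex inj_on_def)
qed

text \<open>As \<open>j\<close>, \<open>M - j\<close> and \<open>M\<close> all exceed
  \<open>n\<close>, the three products in \<open>gauss_binomial_mult\<close> agree with the infinite
  one up to degree \<open>n\<close>; one copy of it cancels.\<close>

lemma agree_gauss_binomial:
  assumes "k > 0" "n < j" "j + n < M"
  shows "agree n (gauss_binomial (fps_X ^ k) M j * euler_prod (range (\<lambda>i. k * Suc i))) 1"
proof -
  let ?E = "euler_prod (range (\<lambda>i. k * Suc i))"
  let ?P = "\<lambda>m. \<Prod>i=1..m. 1 - (fps_X ^ k) ^ i :: bit fps"
  have P: "agree n ?E (?P m)" if "n < m" for m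
  proof -
    have "agree n ?E (\<Prod>i<m. 1 + fps_X ^ (k * Suc i))"
      using assms(1) that by (intro agree_euler_prod_range) (auto simp: inj_on_def trans_le_add2)
    also have "(\<Prod>i<m. 1 + fps_X ^ (k * Suc i)) = ?P m"
      by (simp add: prod.atLeast1_atMost_eq power_mult del: mult_Suc_right)
    finally show ?thesis .
  qed
  have "agree n (gauss_binomial (fps_X ^ k) M j * ?E * ?E)
      (gauss_binomial (fps_X ^ k) M j * ?P j * ?P (M - j))"
    using assms by (intro agree_mult P) auto
  also have "\<dots> = ?P M"
    using assms by (intro gauss_binomial_mult) auto
  also have "agree n \<dots> (1 * ?E)"
    using P[of M] assms by (auto intro: agree_sym)
  finally show ?thesis
    by (rule agree_cancel) (subst euler_prod_nth_0, use assms(1) in auto)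
qed

text \<open>Jacobi's triple product modulo 2, with the monomials \<open>X^a\<close> and \<open>X^b\<close> in place of the two variables.\<close>

theorem theta_eq_euler_prod:
  assumes "a > 0" "b > 0"
  shows "theta a b = euler_prod (range (\<lambda>i. a + (a + b) * i)) * euler_prod (range (\<lambda>i. b + (a + b) * i)) *
    euler_prod (range (\<lambda>i. (a + b) * Suc i))" (is "_ = ?EA * ?EB * ?EC")
proof (rule agree_imp_eq)
  fix n
  \<comment> \<open>A term of degree at most \<open>n\<close> has
    \<open>\<bar>j - N\<bar> \<le> n\<close>. With this \<open>N\<close>, both \<open>j\<close> and
    \<open>2 * N - j\<close> then exceed \<open>n\<close>, as \<open>agree_gauss_binomial\<close>
    demands.\<close>
  define N where "N = Suc (2 * n)"
  have "N > 0" by (simp add: N_def)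
  let ?g = "gauss_binomial (fps_X ^ (a + b)) (2 * N)"
  let ?e = "\<lambda>j. theta_exp a b (int j - int N)"
  have le: "i \<le> c + (a + b) * i" for c i
    using assms by (intro trans_le_add2) simp
  have "agree n (?EA * ?EB * ?EC) ((\<Prod>i<N. 1 + fps_X ^ (a + (a + b) * i)) *
      (\<Prod>i<N. 1 + fps_X ^ (b + (a + b) * i)) * ?EC)"
    using assms le by (intro agree_mult agree_euler_prod_range) (auto simp: inj_on_def N_def)
  also have "\<dots> = (\<Sum>j\<le>2 * N. fps_X ^ ?e j * (?g j * ?EC))"
    using assms by (subst finite_triple_product) (simp_all add: \<open>N > 0\<close> sum_distrib_right mult.assoc)
  also have "agree n \<dots> (theta a b)"
    unfolding agree_def
  proof (intro allI impI)
    fix m assume m: "m \<le> n"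
    have "(fps_X ^ ?e j * (?g j * ?EC)) $ m = of_bool (?e j = m)" for j
    proof (cases "?e j \<le> m")
      case True
      then have "\<bar>int j - int N\<bar> \<le> int n"
        using abs_le_theta_exp[OF assms, of "int j - int N"] m by linarith
      then have "n < j" "j + n < 2 * N"
        by (auto simp: N_def)
      then have "agree n (?g j * ?EC) 1"
        using assms by (intro agree_gauss_binomial) auto
      then have "(?g j * ?EC) $ (m - ?e j) = 1 $ (m - ?e j)"
        using m by (simp add: agree_def)
      with True show ?thesis by (auto simp: fps_X_power_mult_nth)
    qed (auto simp: fps_X_power_mult_nth)
    then have "(\<Sum>j\<le>2 * N. fps_X ^ ?e j * (?g j * ?EC)) $ m = (\<Sum>j\<le>2 * N. of_bool (?e j = m))"
      by (simp add: fps_sum_nth)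
    also have "\<dots> = of_nat (card {j \<in> {..2 * N}. ?e j = m})"
      by (simp add: of_bool_def sum.If_cases Int_def)
    also have "card {j \<in> {..2 * N}. ?e j = m} = card {t. theta_exp a b t = m}"
    proof (rule bij_betw_same_card)
      show "bij_betw (\<lambda>j. int j - int N) {j \<in> {..2 * N}. ?e j = m} {t. theta_exp a b t = m}"
      proof (rule bij_betw_byWitness[where f' = "\<lambda>t. nat (t + int N)"])
        have "\<bar>t\<bar> \<le> int N" if "theta_exp a b t = m" for t
          using abs_le_theta_exp[OF assms, of t] that m by (simp add: N_def)
        then show "\<forall>t\<in>{t. theta_exp a b t = m}. int (nat (t + int N)) - int N = t"
          "(\<lambda>t. nat (t + int N)) ` {t. theta_exp a b t = m} \<subseteq> {j \<in> {..2 * N}. ?e j = m}"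
          by (force simp: abs_le_iff)+
      qed auto
    qed
    finally show "(\<Sum>j\<le>2 * N. fps_X ^ ?e j * (?g j * ?EC)) $ m = theta a b $ m"
      by (simp add: theta_def)
  qed
  finally show "agree n (theta a b) (?EA * ?EB * ?EC)"
    by (rule agree_sym)
qed

subsection \<open>Eta quotients modulo 2\<close>

lemma theta_mult_nth:
  assumes "a > 0" "b > 0" "c > 0" "d > 0"
  shows "(theta a b * theta c d) $ n = of_nat (card {(s, t). theta_exp a b s + theta_exp c d t = n})"
proof -
  let ?U = "\<lambda>i. {s. theta_exp a b s = i}" and ?V = "\<lambda>i. {t. theta_exp c d t = i}"
  have "(theta a b * theta c d) $ n = of_nat (\<Sum>i=0..n. card (?U i \<times> ?V (n - i)))"
    by (simp add: fps_mult_nth theta_def card_cartesian_product)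
  also have "(\<Sum>i=0..n. card (?U i \<times> ?V (n - i))) = card (\<Union>i\<in>{0..n}. ?U i \<times> ?V (n - i))"
    using assms by (intro card_UN_disjoint[symmetric]) (auto simp: finite_theta_exp)
  also have "(\<Union>i\<in>{0..n}. ?U i \<times> ?V (n - i)) = {(s, t). theta_exp a b s + theta_exp c d t = n}"
    by auto
  finally show ?thesis .
qed

lemma finite_theta_exp_pair:
  assumes "a > 0" "b > 0" "c > 0" "d > 0"
  shows "finite {(s, t). theta_exp a b s + theta_exp c d t = n}"
proof (rule finite_subset)
  show "{(s, t). theta_exp a b s + theta_exp c d t = n} \<subseteq>
      (\<Union>i\<in>{..n}. {s. theta_exp a b s = i}) \<times> (\<Union>i\<in>{..n}. {t. theta_exp c d t = i})"
    by auto
qed (use assms in \<open>simp add: finite_theta_exp\<close>)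

text \<open>The series \<open>f_k\<close> of the introduction. Indexing products by sets of
  exponents turns identities between them into decompositions into residue classes.\<close>

definition euler :: "nat \<Rightarrow> bit fps" where
  "euler k = euler_prod {i. 0 < i \<and> k dvd i}"

lemma euler_nth_0: "euler k $ 0 = 1"
  by (simp add: euler_def euler_prod_nth_0)

lemma euler_nonzero: "euler k \<noteq> 0"
  using euler_nth_0[of k] by auto

lemma range_residue:
  fixes c k :: nat
  assumes "0 < c" "c < k"
  shows "range (\<lambda>i. c + k * i) = {i. i mod k = c}"
proof (intro set_eqI iffI)
  fix x assume "x \<in> {i. i mod k = c}"
  then have "x = c + k * (x div k)" using mod_mult_div_eq[of x k] by simp
  then show "x \<in> range (\<lambda>i. c + k * i)" by blast
qed (use assms in auto)

lemma range_multiples: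
  fixes k :: nat
  assumes "0 < k"
  shows "range (\<lambda>i. k * Suc i) = {i. 0 < i \<and> k dvd i}"
proof (intro set_eqI iffI)
  fix x assume "x \<in> {i. 0 < i \<and> k dvd i}"
  then obtain m where "x = k * m" "m > 0" by (auto elim!: dvdE)
  then have "x = k * Suc (m - 1)" by simp
  then show "x \<in> range (\<lambda>i. k * Suc i)" by blast
qed (use assms in auto)

text \<open>The three progressions of the triple product are the classes of \<open>a\<close>,
  \<open>b\<close> and 0 modulo \<open>a + b\<close>, disjoint because
  \<open>a \<noteq> b\<close>.\<close>

lemma theta_eq_residues:
  assumes "0 < a" "0 < b" "a \<noteq> b"
  shows "theta a b = euler_prod {i. 0 < i \<and> i mod (a + b) \<in> {0, a, b}}"
proof -
  let ?A = "{i. i mod (a + b) = a}" and ?B = "{i. i mod (a + b) = b}"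
    and ?C = "{i. 0 < i \<and> (a + b) dvd i}"
  have set_eq: "{i. 0 < i \<and> i mod (a + b) \<in> {0, a, b}} = (?A \<union> ?B) \<union> ?C"
    using assms by (auto simp: dvd_eq_mod_eq_0 intro: gr0I)
  have "euler_prod ((?A \<union> ?B) \<union> ?C) = euler_prod (?A \<union> ?B) * euler_prod ?C"
    using assms by (intro euler_prod_union) (auto simp: dvd_eq_mod_eq_0)
  also have "euler_prod (?A \<union> ?B) = euler_prod ?A * euler_prod ?B"
    using assms by (intro euler_prod_union) auto
  also have "\<dots> * euler_prod ?C = theta a b"
    using assms range_residue[of a "a + b"] range_residue[of b "a + b"] range_multiples[of "a + b"]
    by (simp only: theta_eq_euler_prod add_pos_pos less_add_same_cancel1 less_add_same_cancel2)
  finally show ?thesis by (simp only: set_eq)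
qed

text \<open>The classes 0, \<open>k\<close>, \<open>2k\<close> modulo \<open>3k\<close> make up the
  multiples of \<open>k\<close>: Euler's pentagonal number theorem modulo 2.\<close>

lemma theta_pentagonal:
  assumes "0 < k"
  shows "theta k (2 * k) = euler k"
proof -
  have "i mod (3 * k) \<in> {0, k, 2 * k} \<longleftrightarrow> k dvd i" for i
  proof
    assume "k dvd i"
    then obtain m where m: "i = k * m" ..
    then have "i mod (3 * k) = k * (m mod 3)" by (simp add: mult.commute mod_mult_mult2)
    moreover have "m mod 3 \<in> {0, 1, 2}" by auto
    ultimately show "i mod (3 * k) \<in> {0, k, 2 * k}" by auto
  next
    assume "i mod (3 * k) \<in> {0, k, 2 * k}"
    then have "k dvd i mod (3 * k)" by auto
    then show "k dvd i" by (simp add: dvd_mod_iff)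
  qed
  with assms show ?thesis
    by (subst theta_eq_residues) (auto simp: euler_def)
qed

lemma euler_square: "euler k ^ 2 = euler (2 * k)"
proof -
  have "(*) 2 ` {i. 0 < i \<and> k dvd i} = {i. 0 < i \<and> 2 * k dvd i}"
    by (auto elim!: dvdE)
  then show ?thesis by (simp add: euler_def euler_prod_square)
qed

text \<open>Odd numbers and multiples of 4 give \<open>f_1 f_4 / f_2\<close>, and squaring turns
  this into \<open>f_1^3\<close>: Jacobi's identity for the cube, modulo 2.\<close>

lemma theta_1_3: "theta 1 3 = euler 1 ^ 3"
proof -
  let ?O = "{i::nat. odd i}"
  have "euler 1 = euler_prod (?O \<union> {i. 0 < i \<and> 2 dvd i})"
    unfolding euler_def by (rule arg_cong[where f = euler_prod]) (auto intro: gr0I)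
  also have "\<dots> = euler_prod ?O * euler 2"
    unfolding euler_def by (rule euler_prod_union) auto
  finally have 1: "euler 1 = euler_prod ?O * euler 2" .
  have set_eq: "{i::nat. 0 < i \<and> i mod (1 + 3) \<in> {0, 1, 3}} = ?O \<union> {i. 0 < i \<and> 4 dvd i}"
    by (auto, presburger+)
  have "theta 1 3 = euler_prod {i. 0 < i \<and> i mod (1 + 3) \<in> {0, 1, 3}}"
    by (rule theta_eq_residues) auto
  also have "\<dots> = euler_prod (?O \<union> {i. 0 < i \<and> 4 dvd i})"
    unfolding set_eq ..
  also have "euler_prod (?O \<union> {i. 0 < i \<and> 4 dvd i}) = euler_prod ?O * euler 4"
    unfolding euler_def by (rule euler_prod_union) auto
  finally have "theta 1 3 * euler 2 = euler 1 * euler 4"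
    using 1 by (simp add: mult_ac)
  also have "\<dots> = euler 1 ^ 3 * euler 2"
    using euler_square[of 2] euler_square[of 1] by (simp add: power2_eq_square power3_eq_cube mult_ac)
  finally show ?thesis
    using euler_nonzero[of 2] by simp
qed

text \<open>Sorting exponents modulo 6 gives \<open>f_1 f_6^2 / (f_2 f_3)\<close>, which is
  \<open>f_3^3 / f_1\<close> by squaring.\<close>

lemma theta_1_5: "theta 1 5 * euler 1 = euler 3 ^ 3"
proof -
  let ?O = "{i::nat. i mod 6 \<in> {1, 5}}" and ?T = "{i::nat. i mod 6 = 3}"
  have "euler 1 = euler_prod ((?O \<union> ?T) \<union> {i. 0 < i \<and> 2 dvd i})"
    unfolding euler_def by (rule arg_cong[where f = euler_prod]) (auto, presburger+)
  also have "\<dots> = euler_prod (?O \<union> ?T) * euler 2"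
    unfolding euler_def by (rule euler_prod_union) (auto, presburger+)
  also have "euler_prod (?O \<union> ?T) = euler_prod ?O * euler_prod ?T"
    by (rule euler_prod_union) auto
  finally have 1: "euler 1 = euler_prod ?O * euler_prod ?T * euler 2" .
  have "euler 3 = euler_prod (?T \<union> {i. 0 < i \<and> 6 dvd i})"
    unfolding euler_def by (rule arg_cong[where f = euler_prod]) (auto, presburger+)
  also have "\<dots> = euler_prod ?T * euler 6"
    unfolding euler_def by (rule euler_prod_union) auto
  finally have 2: "euler 3 = euler_prod ?T * euler 6" .
  have set_eq: "{i::nat. 0 < i \<and> i mod (1 + 5) \<in> {0, 1, 5}} = ?O \<union> {i. 0 < i \<and> 6 dvd i}"
    by (auto simp: dvd_eq_mod_eq_0 intro: gr0I)
  have "theta 1 5 = euler_prod {i. 0 < i \<and> i mod (1 + 5) \<in> {0, 1, 5}}"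
    by (rule theta_eq_residues) auto
  also have "\<dots> = euler_prod (?O \<union> {i. 0 < i \<and> 6 dvd i})"
    unfolding set_eq ..
  also have "euler_prod (?O \<union> {i. 0 < i \<and> 6 dvd i}) = euler_prod ?O * euler 6"
    unfolding euler_def by (rule euler_prod_union) auto
  finally have "theta 1 5 * euler 2 * euler 3 = euler 1 * euler 6 ^ 2"
    using 1 2 by (simp add: mult_ac power2_eq_square)
  moreover have "euler 2 = euler 1 * euler 1" "euler 6 = euler 3 * euler 3"
    using euler_square[of 1] euler_square[of 3] by (simp_all add: power2_eq_square)
  ultimately have "theta 1 5 * euler 1 * (euler 1 * euler 3) = euler 3 ^ 3 * (euler 1 * euler 3)"
    by (simp only: power2_eq_square power3_eq_cube mult_ac)
  then show ?thesis
    using euler_nonzero by (metis mult_eq_0_iff mult_right_cancel)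
qed

lemma euler_nth:
  assumes "0 < k"
  shows "euler k $ n = of_nat (card {t. theta_exp k (2 * k) t = n})"
  using assms by (simp add: theta_pentagonal[symmetric] theta_def)

text \<open>The pentagonal exponents are homogeneous in \<open>k\<close>, so passing to
  \<open>m * k\<close> multiplies each of them by \<open>m\<close>.\<close>

lemma euler_nth_dilate:
  assumes "0 < k" "0 < m"
  shows "euler (m * k) $ n = (if m dvd n then euler k $ (n div m) else 0)"
proof -
  have "theta_exp (m * k) (2 * (m * k)) t = m * theta_exp k (2 * k) t" for t
  proof -
    have "2 * int (theta_exp (m * k) (2 * (m * k)) t) = int m * (2 * int (theta_exp k (2 * k) t))"
      unfolding two_theta_exp by (simp add: algebra_simps)
    also have "\<dots> = 2 * int (m * theta_exp k (2 * k) t)" by simp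
    finally have "2 * int (theta_exp (m * k) (2 * (m * k)) t) = 2 * int (m * theta_exp k (2 * k) t)" .
    then show ?thesis by (simp only: mult_cancel_left of_nat_eq_iff) simp
  qed
  moreover have "{t. m * theta_exp k (2 * k) t = n} = {}" if "\<not> m dvd n"
    using that by auto
  ultimately show ?thesis
    using assms by (auto simp: euler_nth elim!: dvdE)
qed

lemma regular_gf_mult_euler:
  fixes l :: nat
  assumes "l > 0"
  shows "Abs_fps (\<lambda>n. of_nat (num_regular_partitions l n)) * euler 1 = euler l"
proof -
  \<comment> \<open>This set omits 0, since \<open>l\<close> divides 0.\<close>
  let ?S = "{i. \<not> l dvd i}"
  have "regular_partitions l n = partitions_in ?S n" for n
    by (auto simp: regular_partitions_def partitions_in_def is_partition_def subset_iff intro: gr0I)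
  then have gf: "Abs_fps (\<lambda>n. of_nat (num_regular_partitions l n)) = partition_gf ?S"
    by (simp add: num_regular_partitions_def partition_gf_def)
  have "euler 1 = euler_prod (?S \<union> {i. 0 < i \<and> l dvd i})"
    unfolding euler_def by (rule arg_cong[where f = euler_prod]) (auto intro: gr0I)
  also have "\<dots> = euler_prod ?S * euler l"
    unfolding euler_def by (rule euler_prod_union) auto
  finally show ?thesis
    using partition_gf_mult_euler_prod[of ?S] by (simp add: gf flip: mult.assoc)
qed

subsection \<open>Binary quadratic forms\<close>

lemma even_card_involution:
  assumes "finite A" "\<And>x. x \<in> A \<Longrightarrow> f x \<in> A" "\<And>x. x \<in> A \<Longrightarrow> f (f x) = x"
    and "\<And>x. x \<in> A \<Longrightarrow> f x \<noteq> x"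
  shows "even (card A)"
  using assms
proof (induction "card A" arbitrary: A rule: less_induct)
  case less
  show ?case
  proof (cases "A = {}")
    case False
    then obtain x where x: "x \<in> A" by auto
    let ?B = "A - {x, f x}"
    have sub: "{x, f x} \<subseteq> A" using x less.prems by auto
    have c: "card {x, f x} = 2" using x less.prems(4)[OF x] by auto
    then have cB: "card A = card ?B + 2"
      using card_Diff_subset[OF _ sub] card_mono[OF less.prems(1) sub] by auto
    have "even (card ?B)"
    proof (rule less.hyps)
      fix y assume y: "y \<in> ?B"
      then have "f y \<noteq> x" "f y \<noteq> f x"
        using less.prems(3) x by (metis DiffD1 DiffD2 insertCI)+
      with y show "f y \<in> ?B" using less.prems(2) by auto
    qed (use less.prems cB in auto)
    then show ?thesis using cB by simp
  qed simp
qed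

lemma card_mod_2_involution:
  assumes "finite A" "\<And>x. x \<in> A \<Longrightarrow> f x \<in> A" "\<And>x. x \<in> A \<Longrightarrow> f (f x) = x"
  shows "even (card A) \<longleftrightarrow> even (card {x \<in> A. f x = x})"
proof -
  have "even (card {x \<in> A. f x \<noteq> x})"
    by (rule even_card_involution[where f = f]) (use assms in auto)
  moreover have "card A = card {x \<in> A. f x = x} + card {x \<in> A. f x \<noteq> x}"
    using assms(1) by (subst card_Un_disjoint[symmetric]) (auto intro: arg_cong[where f = card])
  ultimately show ?thesis by simp
qed

text \<open>The congruences are those of \<open>3 t - 1\<close> and \<open>6 s - 1\<close>, whose
  squares occur in the exponents of \<open>theta 1 5\<close> and \<open>euler 3\<close>. They also
  fix the signs.\<close>

definition quad_set :: "int \<Rightarrow> (int \<times> int) set" where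
  "quad_set N = {(z, y). 8 * z\<^sup>2 + 3 * y\<^sup>2 = N \<and> z mod 3 = 2 \<and> y mod 6 = 5}"

lemma even_card_quad_set:
  assumes "finite (quad_set N)" "29 dvd N" "\<not> 29\<^sup>2 dvd N"
  shows "even (card (quad_set N))"
proof -
  \<comment> \<open>\<open>f\<close> multiplies \<open>4z + y\<surd>-6\<close>, of norm \<open>2N\<close>, or its conjugate, by the number
    \<open>(25 + 6\<surd>-6)/29\<close> of norm 1 and fixes the signs. Each point of the set is divisible by
    exactly one of the two primes above 29, and \<open>f\<close> exchanges them, hence has no fixed point.\<close>
  define f :: "int \<times> int \<Rightarrow> int \<times> int" where
    "f = (\<lambda>(z, y). if 29 dvd 25 * z - 9 * y
       then ((9 * y - 25 * z) div 29, - ((25 * y + 24 * z) div 29))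
       else (- ((9 * y + 25 * z) div 29), (24 * z - 25 * y) div 29))"
  have mods: "x = 3 * m + 2 \<Longrightarrow> x mod 3 = 2" "x = 6 * m + 5 \<Longrightarrow> x mod 6 = 5" for x m :: int
    by presburger+
  have types: "(29 dvd 25 * z - 9 * y) \<noteq> (29 dvd 25 * z + 9 * y)" if zy: "(z, y) \<in> quad_set N" for z y
  proof -
    have N: "8 * z\<^sup>2 + 3 * y\<^sup>2 = N"
      using zy by (auto simp: quad_set_def)
    have "\<not> (29 dvd z \<and> 29 dvd y)"
    proof
      assume "29 dvd z \<and> 29 dvd y"
      then obtain a b where "z = 29 * a" "y = 29 * b" by (auto elim!: dvdE)
      then have "N = 29\<^sup>2 * (8 * a\<^sup>2 + 3 * b\<^sup>2)"
        using N by (simp add: algebra_simps power2_eq_square)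
      with assms(3) show False by simp
    qed
    moreover have "29 dvd z \<and> 29 dvd y" if "29 dvd 25 * z - 9 * y" "29 dvd 25 * z + 9 * y"
    proof -
      from that obtain p q where "25 * z - 9 * y = 29 * p" "25 * z + 9 * y = 29 * q"
        by (auto elim!: dvdE)
      \<comment> \<open>Modulo 29, the inverses of 50 and 18 are 18 and 21.\<close>
      then have "z = 29 * (18 * (p + q) - 31 * z)" "y = 29 * (21 * (q - p) - 13 * y)"
        by (simp_all add: algebra_simps)
      then show ?thesis by (metis dvd_triv_left)
    qed
    ultimately have not_both: "\<not> (29 dvd 25 * z - 9 * y \<and> 29 dvd 25 * z + 9 * y)"
      by blast
    have "(25 * z - 9 * y) * (25 * z + 9 * y) = 2 * N + 29 * (21 * z\<^sup>2 - 3 * y\<^sup>2)"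
      using N by (simp add: algebra_simps power2_eq_square)
    then have "29 dvd (25 * z - 9 * y) * (25 * z + 9 * y)"
      using assms(2) by simp
    then have "29 dvd 25 * z - 9 * y \<or> 29 dvd 25 * z + 9 * y"
      using prime_dvd_mult_iff[of "29::int"] by simp
    with not_both show ?thesis by blast
  qed
  have main: "f (z, y) \<in> quad_set N \<and> f (f (z, y)) = (z, y) \<and> f (z, y) \<noteq> (z, y)"
    if zy: "(z, y) \<in> quad_set N" for z y
  proof -
    have N: "8 * z\<^sup>2 + 3 * y\<^sup>2 = N" and m: "z mod 3 = 2" "y mod 6 = 5"
      using zy by (auto simp: quad_set_def)
    define k l where "k = z div 3" "l = y div 6"
    have kl: "z = 3 * k + 2" "y = 6 * l + 5"
      using m by (simp_all add: k_l_def minus_mod_eq_mult_div[symmetric])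
    show ?thesis
    proof (cases "29 dvd 25 * z - 9 * y")
      case True
      then obtain a where a: "25 * z - 9 * y = 29 * a" by (auto elim: dvdE)
      \<comment> \<open>Modulo 29, \<open>23 (25 z - 9 y)\<close> is \<open>24 z + 25 y\<close>, so
        one divisibility makes both coordinates integral.\<close>
      define b where "b = 23 * a + 8 * y - 19 * z"
      have b: "25 * y + 24 * z = 29 * b" using a by (simp add: b_def)
      have inv: "25 * a + 9 * b = 29 * z" "25 * b - 24 * a = 29 * y"
        using a b by linarith+
      have "29\<^sup>2 * (8 * a\<^sup>2 + 3 * b\<^sup>2) = 8 * (29 * a)\<^sup>2 + 3 * (29 * b)\<^sup>2"
        by (simp add: algebra_simps)
      also have "\<dots> = 29\<^sup>2 * N"
        unfolding a[symmetric] b[symmetric] N[symmetric] by (simp add: algebra_simps power2_eq_square)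
      finally have "8 * a\<^sup>2 + 3 * b\<^sup>2 = N" by simp
      moreover have "(- a) mod 3 = 2" "(- b) mod 6 = 5"
      proof -
        \<comment> \<open>Since 29 is -1 modulo 6, dividing by 29 changes the residues by a sign;
          the signs in \<open>f\<close> correct this.\<close>
        have "- a = 3 * (1 + 25 * k - 18 * l - 10 * a) + 2" "- b = 6 * (25 * l + 4 * z - 5 * b + 20) + 5"
          using a b kl by algebra+
        then show "(- a) mod 3 = 2" "(- b) mod 6 = 5" by (blast intro: mods)+
      qed
      ultimately have mem: "(- a, - b) \<in> quad_set N"
        by (simp add: quad_set_def)
      have fzy: "f (z, y) = (- a, - b)"
        using a b True by (simp add: f_def)
      \<comment> \<open>The image satisfies the other divisibility, so the second application of
        \<open>f\<close> takes the other branch and undoes the first. It also follows that the point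
        has moved.\<close>
      have "29 dvd 25 * (- a) + 9 * (- b)"
        using inv by (intro dvdI[of _ _ "- z"]) simp
      then have nd: "\<not> 29 dvd 25 * (- a) - 9 * (- b)" using types[OF mem] by blast
      then have "f (- a, - b) = (z, y)"
        using inv unfolding f_def by (simp add: add.commute)
      then show ?thesis using mem fzy nd True by auto
    next
      case False
      then have "29 dvd 25 * z + 9 * y" using types[OF zy] by blast
      then obtain a where a: "25 * z + 9 * y = 29 * a" by (auto elim: dvdE)
      define b where "b = 23 * a - 8 * y - 19 * z"
      have b: "24 * z - 25 * y = 29 * b" using a by (simp add: b_def)
      have inv: "25 * a + 9 * b = 29 * z" "24 * a - 25 * b = 29 * y"
        using a b by linarith+
      have "29\<^sup>2 * (8 * a\<^sup>2 + 3 * b\<^sup>2) = 8 * (29 * a)\<^sup>2 + 3 * (29 * b)\<^sup>2"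
        by (simp add: algebra_simps)
      also have "\<dots> = 29\<^sup>2 * N"
        unfolding a[symmetric] b[symmetric] N[symmetric] by (simp add: algebra_simps power2_eq_square)
      finally have "8 * a\<^sup>2 + 3 * b\<^sup>2 = N" by simp
      moreover have "(- a) mod 3 = 2" "b mod 6 = 5"
      proof -
        have "- a = 3 * (31 + 25 * k + 18 * l - 10 * a) + 2" "b = 6 * (25 * l - 4 * z + 5 * b + 20) + 5"
          using a b kl by algebra+
        then show "(- a) mod 3 = 2" "b mod 6 = 5" by (blast intro: mods)+
      qed
      ultimately have mem: "(- a, b) \<in> quad_set N"
        by (simp add: quad_set_def)
      have fzy: "f (z, y) = (- a, b)"
        using a b False by (simp add: f_def add.commute)
      have d: "29 dvd 25 * (- a) - 9 * b"
        using inv by (intro dvdI[of _ _ "- z"]) simp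
      then have "f (- a, b) = (z, y)"
        using inv unfolding f_def by (simp add: add.commute)
      then show ?thesis using mem fzy d False by auto
    qed
  qed
  show ?thesis
    by (rule even_card_involution[OF assms(1), where f = f]) (use main in \<open>force+\<close>)
qed

text \<open>The congruences are those of \<open>4 s - 1\<close> and \<open>6 t - 1\<close>, whose
  squares occur in the exponents of \<open>theta 1 3\<close> and \<open>euler 21\<close>.\<close>

definition norm7_set :: "int \<Rightarrow> (int \<times> int) set" where
  "norm7_set M = {(a, y). a\<^sup>2 + 7 * y\<^sup>2 = 16 * M \<and> a mod 4 = 3 \<and> y mod 6 = 5}"

text \<open>The product of the two numbers is \<open>16 (M - y^2)\<close>, divisible by 32. Their
  halves have the odd sum \<open>a\<close>, so one half is odd and 8 divides the other.\<close>

lemma norm7_dvd: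
  fixes a y M :: int
  assumes "a\<^sup>2 + 7 * y\<^sup>2 = 16 * M" "odd a" "odd y" "odd M"
  shows "16 dvd a - 3 * y \<or> 16 dvd a + 3 * y"
proof -
  have "even (a - 3 * y)" "even (a + 3 * y)" "even (M - y\<^sup>2)"
    using assms by simp_all
  then obtain p q w where p: "a - 3 * y = 2 * p" and q: "a + 3 * y = 2 * q" and w: "M - y\<^sup>2 = 2 * w"
    unfolding dvd_def by blast
  have "(2 * p) * (2 * q) = 16 * (M - y\<^sup>2)"
    unfolding p[symmetric] q[symmetric] using assms(1) by (simp add: algebra_simps power2_eq_square)
  then have "p * q = 2 ^ 3 * w"
    using w by simp
  then have dvd: "2 ^ 3 dvd p * q" by simp
  have "p + q = a" using p q by simp
  then consider "odd p" | "odd q" using assms(2) by auto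
  then show ?thesis
  proof cases
    case 1
    then have "2 ^ 3 dvd q"
      using dvd by (simp add: coprime_dvd_mult_right_iff del: power_numeral)
    then show ?thesis unfolding q by auto
  next
    case 2
    then have "2 ^ 3 dvd p"
      using dvd by (simp add: coprime_dvd_mult_left_iff del: power_numeral)
    then show ?thesis unfolding p by auto
  qed
qed

lemma even_card_norm7_set:
  assumes "finite (norm7_set M)" "odd M"
  shows "even (card (norm7_set M)) \<longleftrightarrow> even (card {u. u\<^sup>2 = M \<and> u mod 6 = 5})"
proof -
  define W where "W = {(u, v). u\<^sup>2 + 7 * v\<^sup>2 = M \<and> u mod 3 = 2}"
  \<comment> \<open>An element of norm \<open>4M\<close> of \<open>\<int>[(1 + \<surd>-7)/2]\<close> not divisible by 2 is, up to conjugation, the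
    square \<open>(-3 + \<surd>-7)/2\<close> of a prime above 2 times an element \<open>u + v\<surd>-7\<close> of norm \<open>M\<close>; up to
    sign this product is \<open>(a + y\<surd>-7)/2\<close> with \<open>a = 3u + 7v\<close>, \<open>y = u - 3v\<close>. Since \<open>y\<close> and \<open>u\<close> agree modulo 3,
    conjugation of \<open>u + v\<surd>-7\<close> acts on the set.\<close>
  define g where "g = (\<lambda>(u::int, v). (if (3 * u + 7 * v) mod 4 = 3 then 3 * u + 7 * v
    else - (3 * u + 7 * v), u - 3 * v))"
  define h :: "int \<times> int \<Rightarrow> int \<times> int" where
    "h = (\<lambda>(a, y). if 16 dvd a - 3 * y then ((3 * a + 7 * y) div 16, (a - 3 * y) div 16)
      else ((7 * y - 3 * a) div 16, (- a - 3 * y) div 16))"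
  have h_plus: "h (a, y) = (u, v)" if "a - 3 * y = 16 * v" "3 * a + 7 * y = 16 * u" for a y u v
    using that by (simp add: h_def)
  have h_minus: "h (a, y) = (u, v)"
    if "\<not> 16 dvd a - 3 * y" "- a - 3 * y = 16 * v" "7 * y - 3 * a = 16 * u" for a y u v
    using that by (simp add: h_def)
  have gW: "g (u, v) \<in> norm7_set M \<and> h (g (u, v)) = (u, v)" if "(u, v) \<in> W" for u v
  proof -
    have M: "u\<^sup>2 + 7 * v\<^sup>2 = M" and u: "u mod 3 = 2"
      using that by (auto simp: W_def)
    have "odd (u\<^sup>2 + 7 * v\<^sup>2)" using M assms(2) by simp
    then have uv: "odd (u + v)" by simp
    have "(3 * u + 7 * v)\<^sup>2 + 7 * (u - 3 * v)\<^sup>2 = 16 * M"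
      using M by (simp add: algebra_simps power2_eq_square)
    moreover have "(u - 3 * v) mod 6 = 5" using u uv by presburger
    moreover have "(3 * u + 7 * v) mod 4 \<noteq> 3 \<Longrightarrow> (- (3 * u + 7 * v)) mod 4 = 3" using uv by presburger
    ultimately have "g (u, v) \<in> norm7_set M"
      by (auto simp: g_def norm7_set_def power2_eq_square algebra_simps)
    moreover have "h (g (u, v)) = (u, v)"
    proof (cases "(3 * u + 7 * v) mod 4 = 3")
      case True
      then show ?thesis
        by (simp only: g_def case_prod_conv if_True) (rule h_plus; simp)
    next
      case False
      \<comment> \<open>The number is \<open>2 (v - 3 u)\<close> with \<open>v - 3 u\<close> odd, so
        \<open>h\<close> takes its second branch.\<close>
      have "\<not> 16 dvd - (3 * u + 7 * v) - 3 * (u - 3 * v)" using uv by presburger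
      with False show ?thesis
        by (simp only: g_def case_prod_conv if_False) (rule h_minus; simp)
    qed
    ultimately show ?thesis ..
  qed
  have hS: "h (a, y) \<in> W \<and> g (h (a, y)) = (a, y)" if "(a, y) \<in> norm7_set M" for a y
  proof -
    have M: "a\<^sup>2 + 7 * y\<^sup>2 = 16 * M" and a: "a mod 4 = 3" and y: "y mod 6 = 5"
      using that by (auto simp: norm7_set_def)
    \<comment> \<open>Here \<open>b\<close> is \<open>a\<close> or \<open>- a\<close>; the first
      coordinate is forced by \<open>y = u - 3 v\<close>.\<close>
    have key: "(y + 3 * v, v) \<in> W" if "b - 3 * y = 16 * v" "b\<^sup>2 = a\<^sup>2" for b v
    proof -
      have b: "b = 16 * v + 3 * y" using that(1) by simp
      have "16 * ((y + 3 * v)\<^sup>2 + 7 * v\<^sup>2) = b\<^sup>2 + 7 * y\<^sup>2"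
        unfolding b by (simp add: algebra_simps power2_eq_square)
      also have "\<dots> = 16 * M" using M that(2) by simp
      finally have "(y + 3 * v)\<^sup>2 + 7 * v\<^sup>2 = M" by simp
      moreover have "(y + 3 * v) mod 3 = 2" using y by presburger
      ultimately show ?thesis by (simp add: W_def)
    qed
    show ?thesis
    proof (cases "16 dvd a - 3 * y")
      case True
      then obtain v where v: "a - 3 * y = 16 * v" ..
      then have "3 * a + 7 * y = 16 * (y + 3 * v)" by simp
      then have h: "h (a, y) = (y + 3 * v, v)" using v by (simp add: h_def)
      have "3 * (y + 3 * v) + 7 * v = a" using v by simp
      then have "g (y + 3 * v, v) = (a, y)"
        using a by (simp add: g_def del: distrib_left_numeral)
      then show ?thesis using h key[OF v] by simp
    next
      case False
      have "odd a" "odd y" using a y by presburger+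
      then have "16 dvd a + 3 * y" using norm7_dvd[OF M _ _ assms(2)] False by blast
      then obtain w where "a + 3 * y = 16 * w" ..
      then have "- a - 3 * y = 16 * (- w)" by simp
      then obtain v where v: "- a - 3 * y = 16 * v" by blast
      then have "7 * y - 3 * a = 16 * (y + 3 * v)" by simp
      then have h: "h (a, y) = (y + 3 * v, v)" using v False by (simp add: h_def)
      have "3 * (y + 3 * v) + 7 * v = - a" using v by simp
      moreover have "(- a) mod 4 \<noteq> 3" using a by presburger
      ultimately have "g (y + 3 * v, v) = (a, y)"
        by (simp add: g_def del: distrib_left_numeral)
      then show ?thesis using h key[OF v] by simp
    qed
  qed
  have bij: "bij_betw h (norm7_set M) W"
    by (rule bij_betw_byWitness[where f' = g]) (use gW hS in force)+
  define i where "i = (\<lambda>(u::int, v::int). (u, - v))"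
  have "even (card W) \<longleftrightarrow> even (card {x \<in> W. i x = x})"
    using assms(1) bij bij_betw_finite by (intro card_mod_2_involution) (auto simp: W_def i_def)
  also have "{x \<in> W. i x = x} = (\<lambda>u. (u, 0)) ` {u. u\<^sup>2 = M \<and> u mod 6 = 5}"
  proof -
    have "u mod 6 = 5" if "u\<^sup>2 = M" "u mod 3 = 2" for u
    proof -
      have "odd (u\<^sup>2)" using that(1) assms(2) by simp
      then have "odd u" by simp
      then show ?thesis using that(2) by presburger
    qed
    moreover have "u mod 3 = 2" if "u mod 6 = 5" for u :: int
      using that by presburger
    ultimately show ?thesis by (auto simp: W_def i_def)
  qed
  also have "card \<dots> = card {u. u\<^sup>2 = M \<and> u mod 6 = 5}"
    by (intro card_image) (auto simp: inj_on_def)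
  finally show ?thesis
    using bij_betw_same_card[OF bij] by simp
qed

subsection \<open>Parity of 21-regular partitions\<close>

lemma of_nat_bit_eq_iff: "(of_nat m :: bit) = of_nat n \<longleftrightarrow> (even m \<longleftrightarrow> even n)"
proof -
  have "(of_nat k :: bit) = of_bool (odd k)" for k
    by (induction k) auto
  then show ?thesis by simp
qed

text \<open>Completing the square, here and in the next two lemmas, turns equations between
  exponents into quadratic forms.\<close>

lemma theta_exp_1_3: "8 * int (theta_exp 1 3 s) + 1 = (4 * s - 1)\<^sup>2"
  using two_theta_exp[of 1 3 s] by (simp add: algebra_simps power2_eq_square)

lemma theta_exp_pentagonal: "24 * int (theta_exp k (2 * k) t) + int k = int k * (6 * t - 1)\<^sup>2"
  using two_theta_exp[of k "2 * k" t] by (simp add: algebra_simps power2_eq_square)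

lemma theta_exp_1_5: "3 * int (theta_exp 1 5 t) + 1 = (3 * t - 1)\<^sup>2"
  using two_theta_exp[of 1 5 t] by (simp add: algebra_simps power2_eq_square)

text \<open>Eight times the exponent, plus \<open>1 + 7\<close>, is \<open>a^2 + 7 y^2\<close>. For
  exponent \<open>4 m + 1\<close> this is \<open>16 (2 m + 1)\<close>, so
  \<open>even_card_norm7_set\<close> applies with an odd \<open>M\<close>.\<close>

lemma theta_1_3_euler_21_nth: "(theta 1 3 * euler 21) $ (4 * m + 1) = euler 12 $ m"
proof -
  let ?S = "{(s, t). theta_exp 1 3 s + theta_exp 21 42 t = 4 * m + 1}"
  let ?M = "2 * int m + 1"
  have iff: "theta_exp 1 3 s + theta_exp 21 42 t = 4 * m + 1 \<longleftrightarrow>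
      (4 * s - 1)\<^sup>2 + 7 * (6 * t - 1)\<^sup>2 = 16 * ?M" for s t
    using theta_exp_1_3[of s] theta_exp_pentagonal[of 21 t] by auto
  have bij: "bij_betw (\<lambda>(s, t). (4 * s - 1, 6 * t - 1)) ?S (norm7_set ?M)"
  proof (rule bij_betw_byWitness[where f' = "\<lambda>(a, y). ((a + 1) div 4, (y + 1) div 6)"])
    have a: "4 * ((a + 1) div 4) - 1 = a" if "a mod 4 = 3" for a :: int
      using that by presburger
    have y: "6 * ((y + 1) div 6) - 1 = y" if "y mod 6 = 5" for y :: int
      using that by presburger
    have st: "(4 * s - 1) mod 4 = 3" "(6 * s - 1) mod 6 = 5" for s :: int
      by presburger+
    show "(\<lambda>(s, t). (4 * s - 1, 6 * t - 1)) ` ?S \<subseteq> norm7_set ?M"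
      unfolding iff norm7_set_def using st by auto
    show "(\<lambda>(a, y). ((a + 1) div 4, (y + 1) div 6)) ` norm7_set ?M \<subseteq> ?S"
      unfolding iff norm7_set_def using a y by auto
    show "\<forall>x\<in>norm7_set ?M. (\<lambda>(s, t). (4 * s - 1, 6 * t - 1)) ((\<lambda>(a, y). ((a + 1) div 4, (y + 1) div 6)) x) = x"
      unfolding norm7_set_def using a y by auto
  qed auto
  have "finite ?S" by (rule finite_theta_exp_pair) auto
  then have "even (card ?S) \<longleftrightarrow> even (card {u. u\<^sup>2 = ?M \<and> u mod 6 = 5})"
    using even_card_norm7_set[of ?M] bij by (simp add: bij_betw_same_card bij_betw_finite)
  also have "card {u. u\<^sup>2 = ?M \<and> u mod 6 = 5} = card {t. theta_exp 12 24 t = m}"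
  proof (rule bij_betw_same_card)
    have iff: "theta_exp 12 24 t = m \<longleftrightarrow> (6 * t - 1)\<^sup>2 = ?M" for t
      using theta_exp_pentagonal[of 12 t] by auto
    show "bij_betw (\<lambda>u. (u + 1) div 6) {u. u\<^sup>2 = ?M \<and> u mod 6 = 5} {t. theta_exp 12 24 t = m}"
    proof (rule bij_betw_byWitness[where f' = "\<lambda>t. 6 * t - 1"])
      have u: "6 * ((u + 1) div 6) - 1 = u" if "u mod 6 = 5" for u :: int
        using that by presburger
      have t: "(6 * t - 1) mod 6 = 5" for t :: int
        by presburger
      show "(\<lambda>u. (u + 1) div 6) ` {u. u\<^sup>2 = ?M \<and> u mod 6 = 5} \<subseteq> {t. theta_exp 12 24 t = m}"
        unfolding iff using u by auto
      show "(\<lambda>t. 6 * t - 1) ` {t. theta_exp 12 24 t = m} \<subseteq> {u. u\<^sup>2 = ?M \<and> u mod 6 = 5}"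
        unfolding iff using t by auto
      show "\<forall>x\<in>{u. u\<^sup>2 = ?M \<and> u mod 6 = 5}. 6 * ((x + 1) div 6) - 1 = x"
        using u by auto
    qed auto
  qed
  finally have "(of_nat (card ?S) :: bit) = of_nat (card {t. theta_exp 12 24 t = m})"
    by (simp only: of_nat_bit_eq_iff)
  then show ?thesis
    using theta_mult_nth[of 1 3 21 42 "4 * m + 1"] theta_pentagonal[of 21] euler_nth[of 12 m] by simp
qed

text \<open>As \<open>f\<^sub>4 \<equiv> f\<^sub>1^4\<close>, the series \<open>f\<^sub>1^3 f\<^sub>2\<^sub>1\<close> is the generating function times \<open>f\<^sub>1(q^4)\<close>,
  so the section of the former at exponents \<open>4m + 1\<close> is that of the latter times \<open>f\<^sub>1\<close>.\<close>

lemma regular_21_section_gf: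
  "Abs_fps (\<lambda>m. of_nat (num_regular_partitions 21 (4 * m + 1))) = euler 3 * theta 1 5"
    (is "?F = _")
proof -
  define B :: "bit fps" where "B = Abs_fps (\<lambda>n. of_nat (num_regular_partitions 21 n))"
  have sq: "euler 2 = euler 1 ^ 2" "euler 4 = euler 2 ^ 2" "euler 6 = euler 3 ^ 2" "euler 12 = euler 6 ^ 2"
    by (simp_all add: euler_square)
  have "B * euler 1 = euler 21"
    unfolding B_def by (rule regular_gf_mult_euler) simp
  then have "B * euler 4 = theta 1 3 * euler 21"
    unfolding sq theta_1_3 by (simp add: power2_eq_square power3_eq_cube mult_ac)
  then have "(B * euler 4) $ (4 * m + 1) = euler 12 $ m" for m
    by (simp only: theta_1_3_euler_21_nth)
  moreover have "(B * euler 4) $ (4 * m + 1) = (?F * euler 1) $ m" for m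
  proof -
    have "(B * euler 4) $ (4 * m + 1) = (\<Sum>i\<le>4 * m + 1. euler 4 $ i * B $ (4 * m + 1 - i))"
      by (subst mult.commute) (simp add: fps_mult_nth atLeast0AtMost)
    \<comment> \<open>As \<open>f_4\<close> is a series in \<open>q^4\<close>, only
      \<open>i = 4 j\<close> contributes, and \<open>4 m + 1 - 4 j\<close> is again 1 modulo
      4.\<close>
    also have "\<dots> = (\<Sum>i\<in>(*) 4 ` {..m}. euler 4 $ i * B $ (4 * m + 1 - i))"
    proof (rule sum.mono_neutral_right)
      have "i \<in> (*) 4 ` {..m}" if "i \<le> 4 * m + 1" "4 dvd i" for i
        using that by (auto elim!: dvdE)
      then show "\<forall>i\<in>{..4 * m + 1} - (*) 4 ` {..m}. euler 4 $ i * B $ (4 * m + 1 - i) = 0"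
        using euler_nth_dilate[of 1 4] by auto
    qed auto
    also have "\<dots> = (\<Sum>j\<le>m. euler 1 $ j * ?F $ (m - j))"
      using euler_nth_dilate[of 1 4]
      by (subst sum.reindex) (auto simp: inj_on_def B_def diff_mult_distrib2 Suc_diff_le intro!: sum.cong)
    also have "\<dots> = (?F * euler 1) $ m"
      by (subst mult.commute) (simp add: fps_mult_nth atLeast0AtMost)
    finally show ?thesis .
  qed
  ultimately have "?F * euler 1 = euler 12"
    by (intro fps_ext) simp
  also have "\<dots> = euler 3 * (theta 1 5 * euler 1)"
    unfolding theta_1_5 sq by (simp add: power2_eq_square power3_eq_cube mult_ac)
  finally have "?F * euler 1 = euler 3 * theta 1 5 * euler 1"
    by (simp add: mult.assoc)
  then show ?thesis
    using euler_nonzero[of 1] by (metis mult_right_cancel)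
qed

text \<open>Multiplying exponents by 24 and completing squares adds 8 for \<open>theta 1 5\<close>
  and 3 for \<open>euler 3\<close>, whence the 11.\<close>

lemma even_num_regular_partitions_21_iff:
  shows finite_quad_set: "finite (quad_set (24 * int m + 11))"
    and "even (num_regular_partitions 21 (4 * m + 1)) \<longleftrightarrow> even (card (quad_set (24 * int m + 11)))"
proof -
  let ?S = "{(s, t). theta_exp 3 6 s + theta_exp 1 5 t = m}" and ?Q = "quad_set (24 * int m + 11)"
  have iff: "theta_exp 3 6 s + theta_exp 1 5 t = m \<longleftrightarrow>
      8 * (3 * t - 1)\<^sup>2 + 3 * (6 * s - 1)\<^sup>2 = 24 * int m + 11" for s t
    using theta_exp_1_5[of t] theta_exp_pentagonal[of 3 s] by auto
  have bij: "bij_betw (\<lambda>(s, t). (3 * t - 1, 6 * s - 1)) ?S ?Q"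
  proof (rule bij_betw_byWitness[where f' = "\<lambda>(z, y). ((y + 1) div 6, (z + 1) div 3)"])
    have z: "3 * ((z + 1) div 3) - 1 = z" if "z mod 3 = 2" for z :: int
      using that by presburger
    have y: "6 * ((y + 1) div 6) - 1 = y" if "y mod 6 = 5" for y :: int
      using that by presburger
    have st: "(3 * s - 1) mod 3 = 2" "(6 * s - 1) mod 6 = 5" for s :: int
      by presburger+
    show "(\<lambda>(s, t). (3 * t - 1, 6 * s - 1)) ` ?S \<subseteq> ?Q"
      unfolding iff quad_set_def using st by auto
    show "(\<lambda>(z, y). ((y + 1) div 6, (z + 1) div 3)) ` ?Q \<subseteq> ?S"
      unfolding iff quad_set_def using z y by auto
    show "\<forall>x\<in>?Q. (\<lambda>(s, t). (3 * t - 1, 6 * s - 1)) ((\<lambda>(z, y). ((y + 1) div 6, (z + 1) div 3)) x) = x"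
      unfolding quad_set_def using z y by auto
  qed auto
  have "finite ?S" by (rule finite_theta_exp_pair) auto
  moreover have "(of_nat (num_regular_partitions 21 (4 * m + 1)) :: bit) = of_nat (card ?S)"
    using arg_cong[OF regular_21_section_gf, of "\<lambda>f. f $ m"]
      theta_mult_nth[of 3 6 1 5 m] theta_pentagonal[of 3] by simp
  ultimately show "finite ?Q" "even (num_regular_partitions 21 (4 * m + 1)) \<longleftrightarrow> even (card ?Q)"
    using bij by (simp_all add: of_nat_bit_eq_iff bij_betw_same_card bij_betw_finite)
qed

theorem theorem1p4:
  fixes \<beta> n :: nat
  assumes "\<beta> \<in> {8, 37, 66, 95, 124, 153, 182, 211, 240, 269, 298, 327, 356, 414, 443, 472,
    501, 530, 559, 588, 617, 646, 675, 704, 733, 762, 791, 820}"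
  shows "[num_regular_partitions 21 (4 * (29\<^sup>2 * n + \<beta>) + 1) = 0] (mod 2)"
proof -
  define N where "N = 24 * int (29\<^sup>2 * n + \<beta>) + 11"
  have N: "N = 29\<^sup>2 * (24 * int n) + (24 * int \<beta> + 11)"
    by (simp add: N_def)
  \<comment> \<open>The listed values are the numbers \<open>8 + 29 j\<close> with
    \<open>j \<le> 28\<close>, except 385, for which
    \<open>24 * 385 + 11 = 11 * 29^2\<close>.\<close>
  have "29 dvd 24 * int \<beta> + 11" "\<not> 29\<^sup>2 dvd 24 * int \<beta> + 11"
    using assms by auto
  then have "29 dvd N" "\<not> 29\<^sup>2 dvd N"
    unfolding N by (simp_all add: dvd_add_right_iff)
  then have "even (card (quad_set N))"
    using finite_quad_set[of "29\<^sup>2 * n + \<beta>"]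
    by (intro even_card_quad_set) (auto simp: N_def)
  then show ?thesis
    using even_num_regular_partitions_21_iff[of "29\<^sup>2 * n + \<beta>"]
    by (simp add: N_def cong_0_iff)
qed

end
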